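(* Let $\preceq$ be a partial order on $\mathbb{R}$ such that the set $\{(x,y)\in\mathbb{R}\times\mathbb{R}: x\preceq y\}$ is a Borel subset of $\mathbb{R}\times\mathbb{R}$, such that $x\preceq y$ implies $x\leqslant y$ for all $x,y\in\mathbb{R}$, and such that the poset $P=(\mathbb{R},\preceq)$ has finite width $k$. Then $\mathbb{R}$ can be partitioned into $k$ chains of $P$, each of which is a Borel subset of $\mathbb{R}$.
   Context: The width of a poset is the maximum size of an antichain in it. A chain is a set of pairwise comparable elements. *)

theory Defs
  imports "HOL-Analysis.Analysis"
begin

definition antichain_on :: "'a set \<Rightarrow> 'a rel \<Rightarrow> 'a set \<Rightarrow> bool" where
  "antichain_on A r S \<longleftrightarrow>
     S \<subseteq> A \<and> (\<forall>x\<in>S. \<forall>y\<in>S. x \<noteq> y \<longrightarrow> (x, y) \<notin> r \<and> (y, x) \<notin> r)"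

text \<open>Finite width \<open>k\<close>: \<open>k\<close> is the maximum size of an antichain. Finiteness of every antichain is
  required explicitly because \<^const>\<open>card\<close> is \<open>0\<close> on infinite sets.\<close>

definition has_finite_width :: "'a set \<Rightarrow> 'a rel \<Rightarrow> nat \<Rightarrow> bool" where
  "has_finite_width A r k \<longleftrightarrow>
     (\<exists>S. antichain_on A r S \<and> finite S \<and> card S = k) \<and>
     (\<forall>S. antichain_on A r S \<longrightarrow> finite S \<and> card S \<le> k)"

end

theory Submission
  imports Defs
begin

text \<open>Dilworth's theorem partitions the line into \<open>k\<close> chains, in general not Borel. But every chain \<open>P\<close>
  is contained in a Borel chain: take a countable \<open>D \<subseteq> P\<close> that contains all points of \<open>P\<close> isolated in \<open>P\<close>
  from the right and is dense in \<open>P\<close>. Each \<open>x \<in> P - D\<close> is comparable to all of \<open>D\<close> and is the limit from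
  the right of points of \<open>D\<close>. These two properties of \<open>x\<close> are Borel, since \<open>D\<close> is countable, and any two
  points \<open>x < y\<close> having them are comparable, since some \<open>d \<in> D\<close> lies in \<open>[x, y]\<close> and comparability to \<open>d\<close>
  can only mean \<open>x \<preceq> d \<preceq> y\<close>. So the \<open>k\<close> chains can be enlarged to Borel chains and then made disjoint.\<close>

section \<open>Dilworth's theorem\<close>

text \<open>Colours instead of a family of chains: colour classes may be empty, so this expresses a
  cover by at most \<open>k\<close> chains and restricts to subsets at once.\<close>

definition chain_coloring :: "'a set \<Rightarrow> 'a rel \<Rightarrow> nat \<Rightarrow> ('a \<Rightarrow> nat) \<Rightarrow> bool" where
  "chain_coloring A r k f \<longleftrightarrow>
     f ` A \<subseteq> {..<k} \<and> (\<forall>x\<in>A. \<forall>y\<in>A. f x = f y \<longrightarrow> (x, y) \<in> r \<or> (y, x) \<in> r)"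

lemma antichain_on_subset: "antichain_on A r S \<Longrightarrow> A \<subseteq> B \<Longrightarrow> antichain_on B r S"
  by (auto simp: antichain_on_def)

lemma chain_coloring_subset: "chain_coloring A r k f \<Longrightarrow> B \<subseteq> A \<Longrightarrow> chain_coloring B r k f"
  unfolding chain_coloring_def by blast

lemma chain_coloring_inj_on_antichain:
  assumes "chain_coloring A r k f" "antichain_on A r S"
  shows "inj_on f S"
  using assms unfolding chain_coloring_def antichain_on_def inj_on_def by blast

text \<open>Points sharing a colour are comparable, so an antichain uses each colour at most once;
  with as many points as colours it uses them all.\<close>

lemma chain_coloring_antichain_onto:
  assumes f: "chain_coloring A r k f" and S: "antichain_on A r S" "finite S" "card S = k"
  shows "f ` S = {..<k}"
proof (rule card_subset_eq)
  show "f ` S \<subseteq> {..<k}"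
    using f S(1) unfolding chain_coloring_def antichain_on_def by blast
  show "card (f ` S) = card {..<k}"
    using card_image[OF chain_coloring_inj_on_antichain[OF f S(1)]] S by simp
qed simp

lemma chain_coloring_add_chain:
  assumes f: "chain_coloring (A - K) r k f" and K: "K \<in> Chains r"
  shows "chain_coloring A r (Suc k) (\<lambda>x. if x \<in> K then k else f x)"
proof -
  have "f x < k" if "x \<in> A" "x \<notin> K" for x
    using f that by (auto simp: chain_coloring_def)
  moreover from this have "f x \<noteq> k" if "x \<in> A" "x \<notin> K" for x
    using that by blast
  ultimately show ?thesis
    using f K by (auto simp: chain_coloring_def Chains_def less_Suc_eq)
qed

lemma finite_has_maximal_on:
  assumes r: "partial_order_on V r" and A: "finite A" "A \<noteq> {}"
  obtains m where "m \<in> A" "\<And>x. x \<in> A \<Longrightarrow> (m, x) \<in> r \<Longrightarrow> x = m"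
proof -
  note po = partial_order_onD[OF r]
  have "asymp_on A (\<lambda>x y. (x, y) \<in> r \<and> x \<noteq> y)" "transp_on A (\<lambda>x y. (x, y) \<in> r \<and> x \<noteq> y)"
    using po by (auto simp: asymp_on_def transp_on_def antisym_def dest: transD)
  from Finite_Set.bex_max_element[OF A(1) this A(2)] show thesis
    using that by blast
qed

text \<open>Galvin's proof.\<close>
lemma dilworth_finite:
  assumes r: "partial_order_on V r" and "finite A" "A \<subseteq> V"
    and "\<And>S. antichain_on A r S \<Longrightarrow> card S \<le> k"
  shows "\<exists>f. chain_coloring A r k f"
  using assms(2-)
proof (induction "card A" arbitrary: A k rule: less_induct)
  case less
  note po = partial_order_onD[OF r]
  show ?case
  proof (cases "A = {}")
    case True
    then have "chain_coloring A r k (\<lambda>_. 0)" by (simp add: chain_coloring_def)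
    then show ?thesis by blast
  next
    case False
    then obtain a where a: "a \<in> A" "\<And>x. x \<in> A \<Longrightarrow> (a, x) \<in> r \<Longrightarrow> x = a"
      using finite_has_maximal_on[OF r \<open>finite A\<close>] by blast
    have "antichain_on A r {a}" using a by (simp add: antichain_on_def)
    from less.prems(3)[OF this] obtain l where k: "k = Suc l" by (cases k) auto
    define B where "B = A - {a}"
    have B: "finite B" "B \<subseteq> A" "a \<notin> B" using less.prems by (auto simp: B_def)
    \<comment> \<open>Removing a chain through \<open>a\<close> that meets every antichain of size
      \<open>k\<close> lowers the width to at most \<open>l\<close>; the induction hypothesis
      colours the rest, and the chain gets the new colour \<open>l\<close>.\<close>
    have reduce: ?thesis
      if K: "a \<in> K" "K \<subseteq> A" "K \<in> Chains r"
        and no: "\<And>S. antichain_on (A - K) r S \<Longrightarrow> card S \<noteq> k" for K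
    proof -
      have "card (A - K) < card A"
        using K less.prems by (intro psubset_card_mono) auto
      moreover have "card S \<le> l" if "antichain_on (A - K) r S" for S
        using no[OF that] less.prems(3)[OF antichain_on_subset[OF that]] k by auto
      ultimately obtain f where "chain_coloring (A - K) r l f"
        using less.hyps[of "A - K" l] less.prems by auto
      then show ?thesis using chain_coloring_add_chain K k by blast
    qed
    show ?thesis
    proof (cases "\<exists>S. antichain_on B r S \<and> card S = k")
      case False
      have "{a} \<in> Chains r"
        using po(1) a less.prems by (auto simp: Chains_def refl_on_def)
      then show ?thesis using reduce[of "{a}"] False a by (auto simp: B_def)
    next
      case True
      then obtain S0 where S0: "antichain_on B r S0" "card S0 = k" by blast
      have "card B < card A"
        using a less.prems by (intro psubset_card_mono) (auto simp: B_def)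
      then obtain f where f: "chain_coloring B r k f"
        using less.hyps[of B k] less.prems antichain_on_subset B
        by (metis subset_trans)
      \<comment> \<open>Inside one colour class \<open>M i\<close> is a chain, so a maximal element
        of it, later called \<open>x i\<close>, is its greatest element.\<close>
      define M where "M i = {x\<in>B. f x = i \<and> (\<exists>S. antichain_on B r S \<and> card S = k \<and> x \<in> S)}" for i
      have meets: "\<exists>y\<in>S. y \<in> M i" if S: "antichain_on B r S" "card S = k" and "i < k" for S i
      proof -
        have "S \<subseteq> B" using S by (simp add: antichain_on_def)
        then have "f ` S = {..<k}"
          using chain_coloring_antichain_onto[OF f S(1)] S(2) B(1) finite_subset by blast
        then obtain y where "y \<in> S" "f y = i" using \<open>i < k\<close> by (metis imageE lessThan_iff)
        then show ?thesis using S \<open>S \<subseteq> B\<close> unfolding M_def by blast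
      qed
      have "\<exists>m\<in>M i. \<forall>y\<in>M i. (y, m) \<in> r" if i: "i < k" for i
      proof -
        have "finite (M i)" "M i \<noteq> {}" using B(1) meets[OF S0 i] by (auto simp: M_def)
        then obtain m where m: "m \<in> M i" "\<And>x. x \<in> M i \<Longrightarrow> (m, x) \<in> r \<Longrightarrow> x = m"
          using finite_has_maximal_on[OF r] by metis
        have "(y, m) \<in> r" if y: "y \<in> M i" for y
          using m(2)[OF y] m(1) y f unfolding M_def chain_coloring_def by fastforce
        then show ?thesis using m by blast
      qed
      then obtain x where x: "\<And>i. i < k \<Longrightarrow> x i \<in> M i"
          "\<And>i y. i < k \<Longrightarrow> y \<in> M i \<Longrightarrow> (y, x i) \<in> r"
        by metis
      have xB: "x i \<in> B" "f (x i) = i" if "i < k" for i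
        using x(1)[OF that] by (auto simp: M_def)
      \<comment> \<open>An antichain of size \<open>k\<close> through \<open>x i\<close> contains
        some \<open>y\<close> in \<open>M j\<close>. As \<open>y\<close> is below
        \<open>x j\<close>, having \<open>x j\<close> below \<open>x i\<close> would make
        \<open>y\<close> and \<open>x i\<close> comparable.\<close>
      have incomp: "(x j, x i) \<notin> r" if ij: "i < k" "j < k" "i \<noteq> j" for i j
      proof
        assume ji: "(x j, x i) \<in> r"
        obtain S where S: "antichain_on B r S" "card S = k" "x i \<in> S"
          using x(1)[OF ij(1)] by (auto simp: M_def)
        obtain y where y: "y \<in> S" "y \<in> M j" using meets[OF S(1,2) ij(2)] by blast
        have "(y, x i) \<in> r" using x(2)[OF ij(2) y(2)] ji po(2) by (meson transD)
        moreover have "y \<noteq> x i" using y(2) xB(2)[OF ij(1)] ij(3) by (auto simp: M_def)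
        ultimately show False using S y(1) by (auto simp: antichain_on_def)
      qed
      \<comment> \<open>Otherwise the points \<open>x i\<close> and the maximal point
        \<open>a\<close> would form an antichain of size \<open>k + 1\<close>.\<close>
      have "\<exists>i<k. (x i, a) \<in> r"
      proof (rule ccontr)
        assume neg: "\<not> ?thesis"
        define X where "X = insert a (x ` {..<k})"
        have "(a, x i) \<notin> r" if "i < k" for i
          using a(2)[of "x i"] xB[OF that] B by auto
        then have "antichain_on A r X"
          using neg incomp a(1) xB(1) B(2) unfolding antichain_on_def X_def by blast
        moreover have "inj_on x {..<k}" by (metis inj_onI lessThan_iff xB(2))
        then have "card X = Suc k"
          using B(3) xB(1) by (subst X_def, subst card_insert_disjoint) (auto simp: card_image)
        ultimately show False using less.prems(3)[of X] by simp
      qed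
      then obtain i where i: "i < k" "(x i, a) \<in> r" by blast
      \<comment> \<open>The colour class is cut off at \<open>x i\<close> so that all of
        \<open>K\<close> lies below \<open>a\<close>. Still, each antichain of size \<open>k\<close>
        in \<open>B\<close> has a point in \<open>M i\<close>, which is below \<open>x i\<close> and
        so in \<open>K\<close>.\<close>
      define K where "K = insert a {z\<in>B. f z = i \<and> (z, x i) \<in> r}"
      show ?thesis
      proof (rule reduce)
        show "a \<in> K" "K \<subseteq> A" using a B by (auto simp: K_def)
        have "(z, a) \<in> r" if "z \<in> K" for z
          using that i po(1,2) a less.prems unfolding K_def refl_on_def by (blast dest: transD)
        moreover have "(y, z) \<in> r \<or> (z, y) \<in> r" if "y \<in> K - {a}" "z \<in> K - {a}" for y z
          using that f by (auto simp: K_def chain_coloring_def)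
        ultimately show "K \<in> Chains r" unfolding Chains_def by blast
        show "card S \<noteq> k" if S: "antichain_on (A - K) r S" for S
        proof
          assume "card S = k"
          moreover have "antichain_on B r S"
            using S by (auto simp: antichain_on_def B_def K_def)
          ultimately obtain y where y: "y \<in> S" "y \<in> M i" using meets i by blast
          then have "y \<in> K" using x(2)[OF i(1) y(2)] by (auto simp: K_def M_def)
          then show False using S y by (auto simp: antichain_on_def)
        qed
      qed
    qed
  qed
qed

text \<open>A set \<open>C\<close> that satisfies the property \<open>P\<close> below is a chain, and the property is of finite character
  (Dilworth's ``strongly dependent'' chains). A maximal such \<open>C\<close> meets every antichain of maximum size.\<close>
theorem dilworth:
  assumes r: "partial_order_on V r" and "A \<subseteq> V"
    and "\<And>S. antichain_on A r S \<Longrightarrow> finite S \<and> card S \<le> k"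
  shows "\<exists>f. chain_coloring A r k f"
  using assms(2-)
proof (induction k arbitrary: A)
  case 0
  have "A = {}"
  proof (rule ccontr)
    assume "A \<noteq> {}"
    then obtain a where "a \<in> A" by blast
    then have "antichain_on A r {a}" by (simp add: antichain_on_def)
    then show False using 0(2)[of "{a}"] by simp
  qed
  then show ?case by (simp add: chain_coloring_def)
next
  case (Suc k)
  \<comment> \<open>The last colour \<open>k\<close> is meant for the chain to be split off. The
    colouring may vary with \<open>S\<close>: hence the finite theorem gives \<open>P {}\<close>,
    and \<open>P\<close> passes to unions of chains of sets.\<close>
  define P where "P C \<longleftrightarrow> C \<subseteq> A \<and> (\<forall>S. finite S \<and> S \<subseteq> A \<longrightarrow>
    (\<exists>f. chain_coloring S r (Suc k) f \<and> (\<forall>x\<in>S \<inter> C. f x = k)))" for C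
  have "\<exists>M\<in>Collect P. \<forall>X\<in>Collect P. M \<subseteq> X \<longrightarrow> X = M"
  proof (rule subset_Zorn_nonempty)
    have "\<exists>f. chain_coloring S r (Suc k) f" if "finite S" "S \<subseteq> A" for S
      using dilworth_finite[OF r that(1), of "Suc k"] Suc.prems that antichain_on_subset
      by (metis subset_trans)
    then have "P {}" by (auto simp: P_def)
    then show "Collect P \<noteq> {}" by blast
  next
    fix \<C> assume C: "\<C> \<noteq> {}" "subset.chain (Collect P) \<C>"
    then have sub: "\<C> \<subseteq> Collect P" by (simp add: subset.chain_def)
    have "\<exists>f. chain_coloring S r (Suc k) f \<and> (\<forall>x\<in>S \<inter> \<Union>\<C>. f x = k)"
      if S: "finite S" "S \<subseteq> A" for S
    proof -
      obtain Y where "Y \<in> \<C>" "S \<inter> \<Union>\<C> \<subseteq> Y"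
        using finite_subset_Union_chain[of "S \<inter> \<Union>\<C>" \<C> "Collect P"] C S by blast
      moreover have "P Y" using sub \<open>Y \<in> \<C>\<close> by blast
      ultimately show ?thesis using S unfolding P_def by (metis IntD1 IntI subsetD)
    qed
    moreover have "\<Union>\<C> \<subseteq> A" using sub unfolding P_def by blast
    ultimately show "\<Union>\<C> \<in> Collect P" by (simp add: P_def)
  qed
  then obtain C where PC: "P C" and max: "\<And>X. P X \<Longrightarrow> C \<subseteq> X \<Longrightarrow> X = C" by blast
  have CA: "C \<subseteq> A" using PC by (simp add: P_def)
  have good: "\<exists>f. chain_coloring S r (Suc k) f \<and> (\<forall>x\<in>S \<inter> C. f x = k)"
    if "finite S" "S \<subseteq> A" for S
    using PC that by (simp add: P_def)
  have chain: "C \<in> Chains r"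
    unfolding Chains_def
  proof (intro CollectI ballI)
    fix x y assume "x \<in> C" "y \<in> C"
    with good[of "{x, y}"] CA show "(x, y) \<in> r \<or> (y, x) \<in> r"
      by (auto simp: chain_coloring_def)
  qed
  have "finite S \<and> card S \<le> k" if S: "antichain_on (A - C) r S" for S
  proof -
    have SA: "antichain_on A r S" "S \<subseteq> A" "S \<inter> C = {}"
      using S by (auto simp: antichain_on_def)
    then have fin: "finite S" "card S \<le> Suc k" using Suc.prems by auto
    have "card S \<noteq> Suc k"
    proof
      assume card: "card S = Suc k"
      \<comment> \<open>By maximality no point \<open>a\<close> of \<open>S\<close> can be added to
        \<open>C\<close>; a finite set witnesses this.\<close>
      have "\<exists>T. finite T \<and> T \<subseteq> A \<and>
          \<not> (\<exists>f. chain_coloring T r (Suc k) f \<and> (\<forall>x\<in>T \<inter> insert a C. f x = k))"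
        if "a \<in> S" for a
      proof -
        have "insert a C \<noteq> C" "insert a C \<subseteq> A" using that SA CA by auto
        then have "\<not> P (insert a C)" using max[of "insert a C"] by blast
        then show ?thesis using \<open>insert a C \<subseteq> A\<close> unfolding P_def by blast
      qed
      then obtain T where T: "\<And>a. a \<in> S \<Longrightarrow> finite (T a)" "\<And>a. a \<in> S \<Longrightarrow> T a \<subseteq> A"
        and bad: "\<And>a f. a \<in> S \<Longrightarrow> chain_coloring (T a) r (Suc k) f \<Longrightarrow>
          \<exists>x\<in>T a \<inter> insert a C. f x \<noteq> k"
        by metis
      \<comment> \<open>One finite set containing all witnesses. In a good colouring of it
        \<open>S\<close> uses every colour, so some \<open>a\<close> in \<open>S\<close> gets colour
        \<open>k\<close>, which the witness \<open>T a\<close> forbids.\<close>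
      define U where "U = S \<union> (\<Union>a\<in>S. T a)"
      have "finite U" "U \<subseteq> A" using T fin SA by (auto simp: U_def)
      then obtain f where f: "chain_coloring U r (Suc k) f" "\<And>x. x \<in> U \<Longrightarrow> x \<in> C \<Longrightarrow> f x = k"
        using good[of U] by blast
      have "antichain_on U r S" using S by (auto simp: antichain_on_def U_def)
      from chain_coloring_antichain_onto[OF f(1) this fin(1) card]
      obtain a where a: "a \<in> S" "f a = k" by (metis imageE lessI lessThan_iff)
      have "T a \<subseteq> U" using a by (auto simp: U_def)
      then show False
        using bad[OF a(1) chain_coloring_subset[OF f(1)]] f(2) a(2) by blast
    qed
    then show ?thesis using fin by simp
  qed
  then obtain f where "chain_coloring (A - C) r k f" using Suc.IH[of "A - C"] Suc.prems by blast
  then show ?case using chain_coloring_add_chain[OF _ chain] by blast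
qed

section \<open>Borel hulls of chains\<close>

text \<open>Choose a rational \<open>q x\<close> bounding a gap to the right of \<open>x\<close>. A
  later such point \<open>x'\<close> is outside this gap, so \<open>q x \<le> x' < q x'\<close>, and
  \<open>q\<close> is injective.\<close>

lemma countable_right_isolated:
  fixes P :: "real set"
  shows "countable {x\<in>P. \<exists>y>x. {x<..<y} \<inter> P = {}}" (is "countable ?L")
proof -
  have "\<exists>q. x < q \<and> {x<..<q} \<inter> P = {} \<and> q \<in> \<rat>" if "x \<in> ?L" for x
  proof -
    obtain y where y: "x < y" "{x<..<y} \<inter> P = {}" using \<open>x \<in> ?L\<close> by blast
    then obtain q where q: "q \<in> \<rat>" "x < q" "q < y" using Rats_dense_in_real by blast
    then have "{x<..<q} \<subseteq> {x<..<y}" by auto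
    then show ?thesis using y q by blast
  qed
  then have "\<forall>x\<in>?L. \<exists>q. x < q \<and> {x<..<q} \<inter> P = {} \<and> q \<in> \<rat>" by blast
  from bchoice[OF this] obtain q
    where q: "\<And>x. x \<in> ?L \<Longrightarrow> x < q x \<and> {x<..<q x} \<inter> P = {} \<and> q x \<in> \<rat>"
    by blast
  have less: "q x < q x'" if "x \<in> ?L" "x' \<in> ?L" "x < x'" for x x'
  proof -
    have "x' \<notin> {x<..<q x}" using q[OF that(1)] that(2) by blast
    then show ?thesis using q[OF that(2)] that(3) by simp
  qed
  have "inj_on q ?L"
  proof (rule inj_onI)
    fix x x' assume "x \<in> ?L" "x' \<in> ?L" "q x = q x'"
    then show "x = x'" using less[of x x'] less[of x' x] by (cases x x' rule: linorder_cases) auto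
  qed
  moreover have "countable (q ` ?L)"
    by (rule countable_subset[OF _ countable_rat]) (use q in blast)
  ultimately show ?thesis using countable_image_inj_on by blast
qed

lemma countable_right_dense_subset:
  fixes P :: "real set"
  obtains D where "countable D" "D \<subseteq> P"
    "\<And>x q. x \<in> P \<Longrightarrow> x \<notin> D \<Longrightarrow> x < q \<Longrightarrow> \<exists>d\<in>D. x \<le> d \<and> d \<le> q"
proof -
  obtain T where T: "countable T" "T \<subseteq> P" "P \<subseteq> closure T"
    by (rule separable)
  define D where "D = T \<union> {x\<in>P. \<exists>y>x. {x<..<y} \<inter> P = {}}"
  show thesis
  proof (rule that[of D])
    show "countable D" "D \<subseteq> P"
      using T countable_right_isolated[of P] by (auto simp: D_def)
    fix x q assume x: "x \<in> P" "x \<notin> D" "x < q"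
    then have "{x<..<q} \<inter> P \<noteq> {}" by (auto simp: D_def)
    then have "{x<..<q} \<inter> closure T \<noteq> {}" using T(3) by blast
    then have "{x<..<q} \<inter> T \<noteq> {}" by (simp add: open_Int_closure_eq_empty)
    then obtain d where "d \<in> T" "x < d" "d < q" by auto
    then show "\<exists>d\<in>D. x \<le> d \<and> d \<le> q" unfolding D_def by (meson UnI1 less_imp_le)
  qed
qed

lemma borel_chain_hull:
  fixes r :: "(real \<times> real) set"
  assumes r: "partial_order_on UNIV r" and meas: "r \<in> sets borel"
    and le: "\<And>x y. (x, y) \<in> r \<Longrightarrow> x \<le> y" and P: "P \<in> Chains r"
  obtains H where "P \<subseteq> H" "H \<in> Chains r" "H \<in> sets borel"
proof -
  note po = partial_order_onD[OF r]
  obtain D where D: "countable D" "D \<subseteq> P"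
    and dense: "\<And>x q. x \<in> P \<Longrightarrow> x \<notin> D \<Longrightarrow> x < q \<Longrightarrow> \<exists>d\<in>D. x \<le> d \<and> d \<le> q"
    using countable_right_dense_subset[of P] by metis
  define cmp where "cmp x d \<longleftrightarrow> (x, d) \<in> r \<or> (d, x) \<in> r" for x d
  \<comment> \<open>Only countable quantifiers occur, which keeps \<open>E\<close> Borel. Rational
    \<open>q\<close> suffice because one lies between any two reals.\<close>
  define E where "E = {x. (\<forall>d\<in>D. cmp x d) \<and> (\<forall>q\<in>\<rat>. x < q \<longrightarrow> (\<exists>d\<in>D. x \<le> d \<and> d \<le> q))}"
  have E: "(x, y) \<in> r" if xy: "x \<in> E" "y \<in> E" "x < y" for x y
  proof -
    obtain q where q: "q \<in> \<rat>" "x < q" "q < y" using Rats_dense_in_real xy by blast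
    then obtain d where d: "d \<in> D" "x \<le> d" "d \<le> q" using xy by (auto simp: E_def)
    have "cmp x d" "cmp y d" using xy d by (auto simp: E_def)
    \<comment> \<open>Since \<open>x \<le> d < y\<close>, the assumption \<open>le\<close> rules out
      the reverse relations, except when \<open>d = x\<close>, where both directions
      coincide.\<close>
    then have "(x, d) \<in> r" "(d, y) \<in> r"
      using le[of d x] le[of y d] d q by (auto simp: cmp_def)
    then show ?thesis using po(2) by (meson transD)
  qed
  have "cmp x y" if "x \<in> D \<union> E" "y \<in> D \<union> E" for x y
  proof (cases "x \<in> E \<and> y \<in> E")
    case True
    then show ?thesis
      using E[of x y] E[of y x] po(1) by (cases x y rule: linorder_cases) (auto simp: cmp_def refl_on_def)
  next
    case False
    then have "x \<in> D \<or> y \<in> D" using that by blast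
    then show ?thesis using that D(2) P by (auto simp: E_def cmp_def Chains_def)
  qed
  then have "D \<union> E \<in> Chains r" by (simp add: Chains_def cmp_def)
  moreover have "P \<subseteq> D \<union> E"
    using D(2) P dense by (fastforce simp: E_def cmp_def Chains_def)
  moreover have "D \<union> E \<in> sets borel"
  proof -
    \<comment> \<open>The set is the preimage of the Borel set \<open>r\<close> under a Borel map
      into the plane; a constant \<open>f\<close> or \<open>g\<close> yields the sections of
      \<open>r\<close> at points of \<open>D\<close>.\<close>
    have [measurable]: "Measurable.pred borel (\<lambda>x. (f x, g x) \<in> r)"
      if [measurable]: "f \<in> borel_measurable borel" "g \<in> borel_measurable borel" for f g :: "real \<Rightarrow> real"
    proof -
      have "(\<lambda>x. (f x, g x)) \<in> measurable borel borel" by measurable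
      from measurable_sets[OF this meas] show ?thesis by (simp add: pred_def vimage_def)
    qed
    have "Measurable.pred borel (\<lambda>x. (\<forall>d\<in>D. cmp x d) \<and>
        (\<forall>q\<in>\<rat>. x < q \<longrightarrow> (\<exists>d\<in>D. x \<le> d \<and> d \<le> q)))"
      unfolding cmp_def using D(1) countable_rat by measurable
    then have "E \<in> sets borel" unfolding E_def by (simp add: pred_def)
    moreover have "D \<in> sets borel" by (rule sets.countable[OF _ D(1)]) simp
    ultimately show ?thesis by simp
  qed
  ultimately show thesis using that by blast
qed

section \<open>Making the Borel hulls disjoint\<close>

theorem theorem2:
  fixes r :: "(real \<times> real) set" and k :: nat
  assumes "partial_order_on UNIV r"
    and "r \<in> sets (borel :: (real \<times> real) measure)"
    and "\<And>x y. (x, y) \<in> r \<Longrightarrow> x \<le> y"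
    and "has_finite_width UNIV r k"
  shows "\<exists>\<C>. partition_on (UNIV :: real set) \<C> \<and> card \<C> = k \<and>
           (\<forall>C\<in>\<C>. C \<in> Chains r \<and> C \<in> sets (borel :: real measure))"
proof -
  obtain S where S: "antichain_on UNIV r S" "finite S" "card S = k"
    using assms(4) by (auto simp: has_finite_width_def)
  obtain f where f: "chain_coloring UNIV r k f"
    using dilworth[OF assms(1) subset_refl, of k] assms(4) by (auto simp: has_finite_width_def)
  have "\<exists>H. {x. f x = i} \<subseteq> H \<and> H \<in> Chains r \<and> H \<in> sets borel" for i
  proof -
    have "{x. f x = i} \<in> Chains r" using f by (auto simp: Chains_def chain_coloring_def)
    from borel_chain_hull[OF assms(1-3) this] show ?thesis by metis
  qed
  then obtain H where H: "\<And>i. {x. f x = i} \<subseteq> H i" "\<And>i. H i \<in> Chains r" "\<And>i. H i \<in> sets borel"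
    by metis
  \<comment> \<open>Recolour by the first hull containing \<open>x\<close>. Since \<open>x\<close>
    lies in \<open>H (f x)\<close>, the new colour is at most \<open>f x\<close>, so
    \<open>k\<close> colours still suffice.\<close>
  define g where "g x = (LEAST i. x \<in> H i)" for x
  have g: "x \<in> H (g x)" "g x \<le> f x" for x
    using H(1)[of "f x"] unfolding g_def by (auto intro: LeastI Least_le)
  have col: "chain_coloring UNIV r k g"
    using f g H(2) unfolding chain_coloring_def Chains_def
    by (smt (verit, best) image_subset_iff UNIV_I le_less_trans lessThan_iff mem_Collect_eq)
  define C where "C i = {x. g x = i}" for i
  \<comment> \<open>The antichain of size \<open>k\<close> meets every new class, so no class is
    empty and there are exactly \<open>k\<close> of them.\<close>
  have onto: "g ` S = {..<k}"
    using chain_coloring_antichain_onto[OF col S] .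
  have g_eq_iff: "g x = i \<longleftrightarrow> x \<in> H i \<and> (\<forall>j<i. x \<notin> H j)" for x i
  proof
    assume "g x = i"
    then show "x \<in> H i \<and> (\<forall>j<i. x \<notin> H j)"
      using g(1)[of x] not_less_Least[of _ "\<lambda>i. x \<in> H i"] unfolding g_def by blast
  next
    assume "x \<in> H i \<and> (\<forall>j<i. x \<notin> H j)"
    then show "g x = i" unfolding g_def by (intro Least_equality) (auto simp: not_less[symmetric])
  qed
  have C_eq: "C i = H i - (\<Union>j<i. H j)" for i
    by (auto simp: C_def g_eq_iff)
  have "\<Union>(C ` {..<k}) = UNIV" "disjoint (C ` {..<k})"
    using col by (auto simp: C_def disjoint_def chain_coloring_def)
  moreover have "C i \<noteq> {}" if "i < k" for i
  proof -
    have "i \<in> g ` S" using that onto by simp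
    then show ?thesis by (auto simp: C_def)
  qed
  ultimately have "partition_on UNIV (C ` {..<k})" by (auto simp: partition_on_def)
  moreover have "inj_on C {..<k}"
  proof (rule inj_onI)
    fix i j assume "i \<in> {..<k}" "C i = C j"
    moreover from this obtain x where "g x = i" using onto by (metis imageE)
    ultimately show "i = j" by (auto simp: C_def)
  qed
  then have "card (C ` {..<k}) = k" by (simp add: card_image)
  moreover have "C i \<in> Chains r" for i
    using col by (auto simp: C_def Chains_def chain_coloring_def)
  moreover have "C i \<in> sets borel" for i
    unfolding C_eq using H(3) by (intro sets.Diff sets.countable_UN') auto
  ultimately show ?thesis by (intro exI[of _ "C ` {..<k}"]) blast
qed

end
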